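(* For every $k\ge1$ there is a constant $C>0$ depending only on $f$ and $k$ such that the following holds. Let $\tilde f_n$ be a piecewise constant left-continuous nonincreasing function on $[0,1]$ with a finite number of jumps. Suppose that $f(1)\le\tilde f_n\le f(0)$, and define its inverse function by $$\tilde U_n(a)=\sup\{x\in[0,1]:\tilde f_n(x)\ge a\},\qquad a\in[f(1),f(0)].$$ Suppose that $[s,t]\subseteq[0,1]$ is such that one of the following situations applies: 1. $\tilde f_n(x)\ge f(x)$ for $x\in(s,t)$, with $\tilde f_n(s)=f(s)$ and $\tilde f_n(t+)\le f(t)$; 2. $\tilde f_n(x)\le f(x)$ for $x\in(s,t)$, with $\tilde f_n(t)=f(t)$ and $\tilde f_n(s)\ge f(s)$. If $$\sup_{x\in[s,t]}|\tilde f_n(x)-f(x)|<\frac{\left(\inf_{x\in[0,1]}|f'(x)|\right)^2}{2\sup_{x\in[0,1]}|f''(x)|},$$ then $$\left|\int_s^t|\tilde f_n(x)-f(x)|^k\,dx-\int_{f(t)}^{f(s)}\frac{|\tilde U_n(a)-g(a)|^k}{|g'(a)|^{k-1}}\,da\right|\le C\int_{f(t)}^{f(s)}\frac{|\tilde U_n(a)-g(a)|^{k+1}}{|g'(a)|^k}\,da.$$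
   Context: $k$ is a real number. $f$ is a decreasing probability density on $[0,1]$ satisfying: (A1) $0<f(1)\le f(y)\le f(x)\le f(0)<\infty$ for $0\le x\le y\le1$; (A2) $f$ is twice continuously differentiable; (A3) $\inf_{x\in(0,1)}|f'(x)|>0$. $g:[f(1),f(0)]\to[0,1]$ denotes the inverse of $f$. $\tilde f_n(t+)$ denotes the right-hand limit at $t$ (read as $\tilde f_n(1)$ if $t=1$). If $\sup_{[0,1]}|f''|=0$, the right-hand side of the bound on $\sup_{[s,t]}|\tilde f_n-f|$ is read as $+\infty$. The function $\tilde f_n$ is deterministic here; the subscript $n$ plays no role. *)

theory Defs
  imports "HOL-Analysis.Analysis"
begin

text \<open>Derivative relative to a set, so that derivatives at the endpoints of a closed interval
  are one-sided and values outside the interval are irrelevant.\<close>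

definition deriv_within :: "real set \<Rightarrow> (real \<Rightarrow> real) \<Rightarrow> real \<Rightarrow> real" where
  "deriv_within S f x = vector_derivative f (at x within S)"

definition twice_cont_diff_on :: "real set \<Rightarrow> (real \<Rightarrow> real) \<Rightarrow> bool" where
  "twice_cont_diff_on S f \<longleftrightarrow>
     f differentiable_on S \<and>
     deriv_within S f differentiable_on S \<and>
     continuous_on S (deriv_within S (deriv_within S f))"

definition prob_density_on :: "real set \<Rightarrow> (real \<Rightarrow> real) \<Rightarrow> bool" where
  "prob_density_on S f \<longleftrightarrow> (\<forall>x\<in>S. 0 \<le> f x) \<and> (f has_integral 1) S"

definition regular_density :: "(real \<Rightarrow> real) \<Rightarrow> bool" where
  "regular_density f \<longleftrightarrow>
     prob_density_on {0..1} f \<and>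
     (0 < f 1 \<and> (\<forall>x y. 0 \<le> x \<and> x \<le> y \<and> y \<le> 1 \<longrightarrow> f 1 \<le> f y \<and> f y \<le> f x \<and> f x \<le> f 0)) \<and>
     twice_cont_diff_on {0..1} f \<and>
     (INF x\<in>{0<..<1}. \<bar>deriv_within {0..1} f x\<bar>) > 0"

text \<open>The inverse of \<open>f\<close>, meaningful on \<open>{f 1..f 0}\<close>, and its derivative there.\<close>

definition inv_density :: "(real \<Rightarrow> real) \<Rightarrow> real \<Rightarrow> real" where
  "inv_density f = the_inv_into {0..1} f"

definition inv_density_deriv :: "(real \<Rightarrow> real) \<Rightarrow> real \<Rightarrow> real" where
  "inv_density_deriv f = deriv_within {f 1..f 0} (inv_density f)"

text \<open>\<open>P\<close> is a finite set containing all jump points; left-continuity at \<open>0\<close> is void,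
  so a jump immediately to the right of \<open>0\<close> is allowed.\<close>

definition dec_step_fun :: "(real \<Rightarrow> real) \<Rightarrow> bool" where
  "dec_step_fun h \<longleftrightarrow>
     (\<exists>P. finite P \<and> (\<forall>c d. {c<..<d} \<subseteq> {0..1} - P \<longrightarrow> h constant_on {c<..<d})) \<and>
     (\<forall>x\<in>{0<..1}. continuous (at_left x) h) \<and>
     (\<forall>x y. 0 \<le> x \<and> x \<le> y \<and> y \<le> 1 \<longrightarrow> h y \<le> h x)"

definition right_lim :: "(real \<Rightarrow> real) \<Rightarrow> real \<Rightarrow> real" where
  "right_lim h t = (if t = 1 then h 1 else Lim (at_right t) h)"

text \<open>The value is unspecified if the set is empty, that is, if \<open>h 0 < a\<close>
  for a nonincreasing \<open>h\<close>; otherwise it lies in \<open>{0..1}\<close>.\<close>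

definition step_inverse :: "(real \<Rightarrow> real) \<Rightarrow> real \<Rightarrow> real" where
  "step_inverse h a = Sup {x\<in>{0..1}. h x \<ge> a}"

definition situation_above :: "(real \<Rightarrow> real) \<Rightarrow> (real \<Rightarrow> real) \<Rightarrow> real \<Rightarrow> real \<Rightarrow> bool" where
  "situation_above f h s t \<longleftrightarrow>
     (\<forall>x\<in>{s<..<t}. h x \<ge> f x) \<and> h s = f s \<and> right_lim h t \<le> f t"

definition situation_below :: "(real \<Rightarrow> real) \<Rightarrow> (real \<Rightarrow> real) \<Rightarrow> real \<Rightarrow> real \<Rightarrow> bool" where
  "situation_below f h s t \<longleftrightarrow>
     (\<forall>x\<in>{s<..<t}. h x \<le> f x) \<and> h t = f t \<and> h s \<ge> f s"

text \<open>If the second derivative of \<open>f\<close> vanishes identically, the bound is \<open>+\<infinity>\<close> and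
  the condition holds for every \<open>h\<close>.\<close>

definition sup_dist_small :: "(real \<Rightarrow> real) \<Rightarrow> (real \<Rightarrow> real) \<Rightarrow> real \<Rightarrow> real \<Rightarrow> bool" where
  "sup_dist_small f h s t \<longleftrightarrow>
     (let m1 = (INF x\<in>{0..1}. \<bar>deriv_within {0..1} f x\<bar>);
          M2 = (SUP x\<in>{0..1}. \<bar>deriv_within {0..1} (deriv_within {0..1} f) x\<bar>)
      in M2 \<noteq> 0 \<longrightarrow> (SUP x\<in>{s..t}. \<bar>h x - f x\<bar>) < m1\<^sup>2 / (2 * M2))"

end

theory Submission
  imports Defs
begin

text \<open>
  Write \<open>g\<close> for the inverse of \<open>f\<close> and \<open>U\<close> for the inverse of the step function \<open>h\<close>. Both integrals
  on the left-hand side are, up to a small error, the same double integral over the region between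
  the graphs of \<open>f\<close> and \<open>h\<close>. Indeed
  \<open>\<bar>h x - f x\<bar> powr k\<close> is the integral of \<open>k * \<bar>a - f x\<bar> powr (k - 1)\<close> over the levels \<open>a\<close> between
  \<open>f x\<close> and \<open>h x\<close>. By Fubini's theorem the integration over \<open>x\<close> can be carried out first, for a fixed
  level \<open>a\<close> between \<open>f t\<close> and \<open>f s\<close>, and the positions to be integrated over are those between
  \<open>g a\<close> and \<open>U a\<close> (\<open>integral_deviation_power_by_level\<close>). Either situation in the theorem confines
  the region to levels between \<open>f t\<close> and \<open>f s\<close> (\<open>situation_levels\<close>).

  On such a section \<open>a = f (g a)\<close>, so the mean value theorem writes \<open>\<bar>f x - a\<bar>\<close> as a slope times
  \<open>\<bar>x - g a\<bar>\<close>. That slope differs from \<open>\<bar>f' (g a)\<bar>\<close> by at most \<open>sup \<bar>f''\<bar> * \<bar>x - g a\<bar>\<close>, and the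
  slopes stay in a compact interval away from \<open>0\<close>, where powers are Lipschitz
  (\<open>deviation_power_linearization\<close>). Integrating over the section gives
  \<open>\<bar>f' (g a)\<bar> powr (k - 1) * \<bar>U a - g a\<bar> powr k\<close> with an error of at most a constant times
  \<open>\<bar>U a - g a\<bar> powr (k + 1)\<close> (\<open>level_slice_estimate\<close>). Since the derivative of \<open>g\<close> is
  \<open>1 / f' (g a)\<close>, the main term is the integrand of the second integral, and, as \<open>\<bar>f'\<bar>\<close> is
  bounded below, the error is controlled by the integrand on the right-hand side.
\<close>

section \<open>Integrals and measurability on intervals\<close>

text \<open>Used along both axes of the plane: vertically, where the distance to \<open>f x\<close> integrates to a
  power of the deviation \<open>h x - f x\<close>, and horizontally, where the distance to \<open>g a\<close> integrates
  to a power of \<open>U a - g a\<close>. The endpoints come in either order because the sign of the deviation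
  is not fixed.\<close>

lemma has_integral_dist_powr:
  fixes c d p :: real
  assumes "p > -1"
  shows "((\<lambda>x. \<bar>x - c\<bar> powr p) has_integral \<bar>d - c\<bar> powr (p + 1) / (p + 1))
           {min c d<..<max c d}"
proof -
  have *: "((\<lambda>x. x powr p) has_integral \<bar>d - c\<bar> powr (p + 1) / (p + 1)) {0..\<bar>d - c\<bar>}"
    using has_integral_powr_from_0[OF assms, of "\<bar>d - c\<bar>"] by simp
  have abs0: "((\<lambda>x. \<bar>x\<bar> powr p) has_integral \<bar>d - c\<bar> powr (p + 1) / (p + 1)) {0..\<bar>d - c\<bar>}"
    by (rule has_integral_eq[OF _ *]) auto
  show ?thesis
  proof (cases "c \<le> d")
    case True
    then show ?thesis
      using has_integral_shift_real_ivl[OF abs0, of "- c"]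
      by (simp add: has_integral_Icc_iff_Ioo)
  next
    case False
    have "((\<lambda>x. \<bar>x\<bar> powr p) has_integral \<bar>d - c\<bar> powr (p + 1) / (p + 1)) {- \<bar>d - c\<bar>..- 0}"
      using abs0 has_integral_reflect_real[of "\<lambda>x. \<bar>x\<bar> powr p" _ "\<bar>d - c\<bar>" 0]
        has_integral_reflect_real[of "\<lambda>x. \<bar>x\<bar> powr p" _ 0 "\<bar>d - c\<bar>"]
      by (simp del: has_integral_reflect_real)
    then show ?thesis
      using False has_integral_shift_real_ivl[of "\<lambda>x. \<bar>x\<bar> powr p" _ "- \<bar>d - c\<bar>" "- 0" "- c"]
      by (simp add: has_integral_Icc_iff_Ioo)
  qed
qed

lemma set_integrable_bounded_interval:
  fixes f :: "real \<Rightarrow> real"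
  assumes f: "f \<in> borel_measurable (restrict_space borel {l<..<u})"
    and B: "\<And>x. x \<in> {l<..<u} \<Longrightarrow> \<bar>f x\<bar> \<le> B"
  shows "set_integrable lborel {l<..<u} f"
  unfolding set_integrable_def
proof (rule integrableI_bounded_set[where A = "{l<..<u}" and B = B])
  show "(\<lambda>x. indicat_real {l<..<u} x *\<^sub>R f x) \<in> borel_measurable lborel"
    using f by (simp add: borel_measurable_restrict_space_iff)
  show "emeasure lborel {l<..<u} < \<infinity>"
    by (cases "l \<le> u") auto
qed (use B in auto)

lemma antimono_on_borel_measurable:
  fixes f :: "real \<Rightarrow> real"
  assumes "antimono_on A f"
  shows "f \<in> borel_measurable (restrict_space borel A)"
proof -
  have "mono_on A (\<lambda>x. - f x)"
    using assms by (auto simp: monotone_on_def)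
  from borel_measurable_mono_on_fnc[OF this]
  have "(\<lambda>x. - (- f x)) \<in> borel_measurable (restrict_space borel A)"
    by (rule borel_measurable_uminus)
  then show ?thesis by simp
qed

section \<open>Exchanging the roles of position and level\<close>

text \<open>The region between the graphs of \<open>f\<close> and \<open>h\<close> over \<open>{s<..<t}\<close> has the vertical sections
  between \<open>f x\<close> and \<open>h x\<close>. Since \<open>g\<close> and \<open>U\<close> tell at which position the graphs of \<open>f\<close> and \<open>h\<close>
  pass the level \<open>a\<close>, its horizontal sections lie between \<open>g a\<close> and \<open>U a\<close>.
  Writing \<open>\<bar>h x - f x\<bar> powr (p + 1)\<close> as the integral of \<open>(p + 1) * \<bar>a - f x\<bar> powr p\<close> over the
  vertical section and applying Fubini's theorem gives an integral over levels. The crossing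
  conditions are symmetric in the two graphs, so the cases \<open>f \<le> h\<close> and \<open>h \<le> f\<close> need no separate
  treatment, and \<open>h\<close> is left unrestricted at the single position \<open>x = U a\<close>, which has measure
  zero.\<close>

lemma integral_deviation_power_by_level:
  fixes f h g U :: "real \<Rightarrow> real" and p :: real
  assumes p: "p \<ge> 0"
    and f_meas: "f \<in> borel_measurable (restrict_space borel {s<..<t})"
    and h_meas: "h \<in> borel_measurable (restrict_space borel {s<..<t})"
    and f_range: "\<And>x. x \<in> {s<..<t} \<Longrightarrow> f x \<in> {l..u}"
    and h_range: "\<And>x. x \<in> {s<..<t} \<Longrightarrow> h x \<in> {l..u}"
    and g_range: "\<And>a. a \<in> {l<..<u} \<Longrightarrow> g a \<in> {s..t}"
    and U_range: "\<And>a. a \<in> {l<..<u} \<Longrightarrow> U a \<in> {s..t}"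
    and g: "\<And>x a. x \<in> {s<..<t} \<Longrightarrow> a \<in> {l<..<u} \<Longrightarrow>
              (f x < a \<longleftrightarrow> g a < x) \<and> (a < f x \<longleftrightarrow> x < g a)"
    and U: "\<And>x a. x \<in> {s<..<t} \<Longrightarrow> a \<in> {l<..<u} \<Longrightarrow>
              (x < U a \<longrightarrow> a \<le> h x) \<and> (U a < x \<longrightarrow> h x < a)"
  defines "G \<equiv> \<lambda>a. integral {min (g a) (U a)<..<max (g a) (U a)}
                      (\<lambda>x. (p + 1) * \<bar>f x - a\<bar> powr p)"
  shows "a \<in> {l<..<u} \<Longrightarrow> (\<lambda>x. (p + 1) * \<bar>f x - a\<bar> powr p)
           integrable_on {min (g a) (U a)<..<max (g a) (U a)}"
    and "G integrable_on {l<..<u}"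
    and "integral {s<..<t} (\<lambda>x. \<bar>h x - f x\<bar> powr (p + 1)) = integral {l<..<u} G"
proof -
  \<comment> \<open>Total measurable versions: \<open>f\<close> and \<open>h\<close> are controlled only on the open interval.\<close>
  define f1 where "f1 = (\<lambda>x. indicat_real {s<..<t} x *\<^sub>R f x)"
  define h1 where "h1 = (\<lambda>x. indicat_real {s<..<t} x *\<^sub>R h x)"
  have [measurable]: "f1 \<in> borel_measurable borel" "h1 \<in> borel_measurable borel"
    using f_meas h_meas by (simp_all add: f1_def h1_def borel_measurable_restrict_space_iff)
  have eq1: "f1 x = f x" "h1 x = h x" if "x \<in> {s<..<t}" for x
    using that by (auto simp: f1_def h1_def)
  define F where "F = (\<lambda>x a. if s < x \<and> x < t \<and> l < a \<and> a < u \<and>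
      (f1 x < a \<and> a \<le> h1 x \<or> h1 x < a \<and> a < f1 x)
      then (p + 1) * \<bar>f1 x - a\<bar> powr p else 0)"
  have F_meas [measurable]: "case_prod F \<in> borel_measurable (lborel \<Otimes>\<^sub>M lborel)"
    unfolding F_def by measurable
  have F_nonneg: "0 \<le> F x a" for x a
    using p by (auto simp: F_def)
  have F_bound: "F x a \<le> (p + 1) * (u - l) powr p" for x a
    using p f_range[of x] eq1[of x]
    by (auto simp: F_def intro!: mult_left_mono powr_mono2)
  have F_sect1: "integrable lborel (\<lambda>x. F x a)" for a
  proof (rule integrableI_bounded_set[where A = "{s<..<t}"])
    show "emeasure lborel {s<..<t} < \<infinity>" by (cases "s \<le> t") auto
    show "AE x in lborel. x \<in> {s<..<t} \<longrightarrow> norm (F x a) \<le> (p + 1) * (u - l) powr p"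
      using F_nonneg F_bound by auto
    show "AE x in lborel. x \<notin> {s<..<t} \<longrightarrow> F x a = 0"
      by (auto simp: F_def)
  qed auto
  have F_sect2: "integrable lborel (F x)" for x
  proof (rule integrableI_bounded_set[where A = "{l<..<u}"])
    show "emeasure lborel {l<..<u} < \<infinity>" by (cases "l \<le> u") auto
    show "AE a in lborel. a \<in> {l<..<u} \<longrightarrow> norm (F x a) \<le> (p + 1) * (u - l) powr p"
      using F_nonneg F_bound by auto
    show "AE a in lborel. a \<notin> {l<..<u} \<longrightarrow> F x a = 0"
      by (auto simp: F_def)
  qed auto
  have F_int: "integrable (lborel \<Otimes>\<^sub>M lborel) (case_prod F)"
  proof (rule integrableI_bounded_set[where A = "{s<..<t} \<times> {l<..<u}"])
    have "emeasure lborel {s<..<t} < \<infinity>" "emeasure lborel {l<..<u} < \<infinity>"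
      by (cases "s \<le> t"; simp) (cases "l \<le> u"; simp)
    then show "emeasure (lborel \<Otimes>\<^sub>M lborel) ({s<..<t} \<times> {l<..<u}) < \<infinity>"
      by (simp add: lborel.emeasure_pair_measure_Times ennreal_mult_less_top)
    show "AE z in lborel \<Otimes>\<^sub>M lborel. z \<in> {s<..<t} \<times> {l<..<u} \<longrightarrow>
        norm (case_prod F z) \<le> (p + 1) * (u - l) powr p"
      using F_nonneg F_bound by auto
    show "AE z in lborel \<Otimes>\<^sub>M lborel. z \<notin> {s<..<t} \<times> {l<..<u} \<longrightarrow> case_prod F z = 0"
    proof (intro AE_I2 impI)
      fix z :: "real \<times> real" assume z: "z \<notin> {s<..<t} \<times> {l<..<u}"
      obtain x a where "z = (x, a)" by fastforce
      with z show "case_prod F z = 0" by (auto simp: F_def)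
    qed
  qed auto

  have vertical: "(LINT a|lborel. F x a) = (if x \<in> {s<..<t} then \<bar>h x - f x\<bar> powr (p + 1) else 0)" for x
  proof (cases "x \<in> {s<..<t}")
    case False
    then have "F x = (\<lambda>_. 0)" by (auto simp: F_def fun_eq_iff)
    with False show ?thesis by auto
  next
    case True
    let ?I = "{min (f x) (h x)<..<max (f x) (h x)}"
    have "((\<lambda>a. \<bar>a - f x\<bar> powr p) has_integral \<bar>h x - f x\<bar> powr (p + 1) / (p + 1)) ?I"
      using has_integral_dist_powr p by simp
    from has_integral_mult_right[OF this, of "p + 1"]
    have "((\<lambda>a. (p + 1) * \<bar>a - f x\<bar> powr p) has_integral \<bar>h x - f x\<bar> powr (p + 1)) ?I"
      using p by simp
    then have "((\<lambda>a. if a \<in> ?I then (p + 1) * \<bar>a - f x\<bar> powr p else 0)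
        has_integral \<bar>h x - f x\<bar> powr (p + 1)) UNIV"
      by (simp only: has_integral_restrict_UNIV)
    \<comment> \<open>The level \<open>h x\<close> belongs to the region in only one of the two cases.\<close>
    then have "(F x has_integral \<bar>h x - f x\<bar> powr (p + 1)) UNIV"
    proof (rule has_integral_spike_finite[rotated 2])
      show "finite {h x}" by simp
      fix a assume "a \<in> UNIV - {h x}"
      then show "F x a = (if a \<in> ?I then (p + 1) * \<bar>a - f x\<bar> powr p else 0)"
        using f_range[OF True] h_range[OF True] True
        by (auto simp: F_def eq1 abs_minus_commute)
    qed
    with has_integral_integral_lborel[OF F_sect2[of x]] True show ?thesis
      by (simp add: has_integral_unique)
  qed

  have horizontal: "((\<lambda>x. (p + 1) * \<bar>f x - a\<bar> powr p) has_integral (LINT x|lborel. F x a))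
      {min (g a) (U a)<..<max (g a) (U a)}" if a: "a \<in> {l<..<u}" for a
  proof -
    let ?I = "{min (g a) (U a)<..<max (g a) (U a)}"
    have "((\<lambda>x. F x a) has_integral (LINT x|lborel. F x a)) UNIV"
      by (rule has_integral_integral_lborel[OF F_sect1])
    then have "((\<lambda>x. if x \<in> ?I then (p + 1) * \<bar>f x - a\<bar> powr p else 0)
        has_integral (LINT x|lborel. F x a)) UNIV"
    proof (rule has_integral_spike_finite[rotated 2])
      show "finite {U a}" by simp
      fix x assume x: "x \<in> UNIV - {U a}"
      show "(if x \<in> ?I then (p + 1) * \<bar>f x - a\<bar> powr p else 0) = F x a"
      proof (cases "x \<in> {s<..<t}")
        case True
        have "g a < x \<and> x < U a \<or> U a < x \<and> x < g a \<longleftrightarrow>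
            f x < a \<and> a \<le> h x \<or> h x < a \<and> a < f x"
        proof (cases "x < U a")
          case less: True
          then have "a \<le> h x" using U[OF True a] by blast
          with less show ?thesis using g[OF True a] by auto
        next
          case False
          with x have less: "U a < x" by simp
          then have "h x < a" using U[OF True a] by blast
          with less show ?thesis using g[OF True a] by auto
        qed
        moreover have "x \<in> ?I \<longleftrightarrow> g a < x \<and> x < U a \<or> U a < x \<and> x < g a"
          by auto
        ultimately have "x \<in> ?I \<longleftrightarrow> f x < a \<and> a \<le> h x \<or> h x < a \<and> a < f x"
          by simp
        then show ?thesis using True a by (simp add: F_def eq1)
      next
        case False
        with g_range[OF a] U_range[OF a] have "x \<notin> ?I" by auto
        with False show ?thesis by (auto simp: F_def)
      qed
    qed
    then show ?thesis by (simp only: has_integral_restrict_UNIV)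
  qed
  have G_eq: "(if a \<in> {l<..<u} then G a else 0) = (LINT x|lborel. F x a)" for a
  proof (cases "a \<in> {l<..<u}")
    case True
    then show ?thesis using integral_unique[OF horizontal] by (simp only: G_def if_True)
  next
    case False
    then have "(\<lambda>x. F x a) = (\<lambda>_. 0)" by (auto simp: F_def fun_eq_iff)
    with False show ?thesis by auto
  qed
  have "integrable lborel (\<lambda>a. LINT x|lborel. F x a)"
    by (rule lborel_pair.integrable_snd[OF F_int])
  then have hi_G: "((\<lambda>a. if a \<in> {l<..<u} then G a else 0)
      has_integral (LINT a|lborel. LINT x|lborel. F x a)) UNIV"
    unfolding G_eq by (rule has_integral_integral_lborel)
  then have G: "(G has_integral (LINT a|lborel. LINT x|lborel. F x a)) {l<..<u}"
    by (simp only: has_integral_restrict_UNIV)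
  have "integrable lborel (\<lambda>x. LINT a|lborel. F x a)"
    by (rule lborel_pair.integrable_fst[OF F_int])
  then have "((\<lambda>x. if x \<in> {s<..<t} then \<bar>h x - f x\<bar> powr (p + 1) else 0)
      has_integral (LINT x|lborel. LINT a|lborel. F x a)) UNIV"
    unfolding vertical[symmetric] by (rule has_integral_integral_lborel)
  then have H: "((\<lambda>x. \<bar>h x - f x\<bar> powr (p + 1))
      has_integral (LINT x|lborel. LINT a|lborel. F x a)) {s<..<t}"
    by (simp only: has_integral_restrict_UNIV)
  show "a \<in> {l<..<u} \<Longrightarrow> (\<lambda>x. (p + 1) * \<bar>f x - a\<bar> powr p)
           integrable_on {min (g a) (U a)<..<max (g a) (U a)}"
    using horizontal by blast
  show "G integrable_on {l<..<u}" using G by blast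
  show "integral {s<..<t} (\<lambda>x. \<bar>h x - f x\<bar> powr (p + 1)) = integral {l<..<u} G"
    using G H lborel_pair.Fubini_integral[OF F_int] by (simp add: integral_unique)
qed

section \<open>Linearization along a horizontal section\<close>

text \<open>Slopes of the density stay in a compact interval away from \<open>0\<close>, so powers of slopes with any
  real exponent can be compared linearly; near \<open>0\<close> this fails for exponents between \<open>0\<close> and
  \<open>1\<close>.\<close>

lemma powr_lipschitz_on_positive_interval:
  fixes m M p :: real
  assumes "0 < m" "m \<le> M"
  obtains L where "L \<ge> 0"
    and "\<And>x y. x \<in> {m..M} \<Longrightarrow> y \<in> {m..M} \<Longrightarrow> \<bar>x powr p - y powr p\<bar> \<le> L * \<bar>x - y\<bar>"
proof -
  let ?d = "\<lambda>z. p * z powr (p - 1)"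
  have "continuous_on {m..M} ?d"
    using assms by (intro continuous_intros) auto
  then have "bounded (?d ` {m..M})"
    by (intro compact_imp_bounded compact_continuous_image) auto
  then obtain L where L: "\<And>z. z \<in> {m..M} \<Longrightarrow> norm (?d z) \<le> L"
    unfolding bounded_iff by blast
  show thesis
  proof
    show "L \<ge> 0" using L[of m] assms order_trans[OF norm_ge_zero] by force
    fix x y assume "x \<in> {m..M}" "y \<in> {m..M}"
    moreover have "((\<lambda>z. z powr p) has_field_derivative ?d z) (at z within {m..M})"
      if "z \<in> {m..M}" for z
      using that assms by (intro has_field_derivative_at_within[OF has_real_derivative_powr]) auto
    ultimately have "norm (x powr p - y powr p) \<le> L * norm (x - y)"
      using field_differentiable_bound[of "{m..M}" "\<lambda>z. z powr p" ?d L x y] L by auto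
    then show "\<bar>x powr p - y powr p\<bar> \<le> L * \<bar>x - y\<bar>" by simp
  qed
qed

text \<open>The bound on \<open>\<bar>z - y\<bar>\<close> is what later turns a Lipschitz condition on \<open>f'\<close> into an error of
  the order \<open>\<bar>x - y\<bar>\<close>; \<open>x\<close> may lie on either side of \<open>y\<close>.\<close>

lemma mvt_unit_interval:
  fixes f f' :: "real \<Rightarrow> real"
  assumes cont: "continuous_on {0..1} f"
    and der: "\<And>x. x \<in> {0<..<1} \<Longrightarrow> (f has_real_derivative f' x) (at x)"
    and "x \<noteq> y" "x \<in> {0..1}" "y \<in> {0..1}"
  shows "\<exists>z\<in>{0<..<1}. \<bar>z - y\<bar> \<le> \<bar>x - y\<bar> \<and> f x - f y = f' z * (x - y)"
proof -
  have *: "\<exists>z. v < z \<and> z < w \<and> f w - f v = f' z * (w - v)"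
    if "v < w" "v \<in> {0..1}" "w \<in> {0..1}" for v w
  proof -
    have "\<exists>z\<in>{v<..<w}. f w - f v = f' z * (w - v)"
    proof (rule mvt[of v w f "\<lambda>z d. f' z * d"])
      show "continuous_on {v..w} f"
        by (rule continuous_on_subset[OF cont]) (use that in auto)
      show "(f has_derivative (\<lambda>d. f' z * d)) (at z)" if "v < z" "z < w" for z
        using der[of z] that \<open>v \<in> {0..1}\<close> \<open>w \<in> {0..1}\<close>
        by (simp add: has_field_derivative_def)
    qed (use \<open>v < w\<close> in auto)
    then show ?thesis by auto
  qed
  show ?thesis
  proof (cases "x < y")
    case True
    then obtain z where "x < z" "z < y" "f y - f x = f' z * (y - x)"
      using *[of x y] assms by blast
    then show ?thesis
      using assms by (intro bexI[of _ z]) (auto simp: algebra_simps)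
  next
    case False
    then obtain z where "y < z" "z < x" "f x - f y = f' z * (x - y)"
      using *[of y x] assms by auto
    then show ?thesis
      using assms by (intro bexI[of _ z]) auto
  qed
qed

text \<open>The increment of \<open>f\<close> from \<open>y\<close> to \<open>x\<close> is \<open>f' z * (x - y)\<close> for some \<open>z\<close> between them, and
  replacing \<open>f' z\<close> by \<open>f' y\<close> costs at most \<open>K * \<bar>x - y\<bar>\<close>. Keeping the slope as a separate factor,
  rather than expanding \<open>f x - f y\<close> itself, makes the error one order smaller than the main term
  even for \<open>p < 1\<close>, where \<open>z \<mapsto> z powr p\<close> is not Lipschitz near \<open>0\<close>.\<close>

lemma deviation_power_linearization:
  fixes f f' :: "real \<Rightarrow> real" and m M K L p :: real
  assumes cont: "continuous_on {0..1} f"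
    and der: "\<And>x. x \<in> {0<..<1} \<Longrightarrow> (f has_real_derivative f' x) (at x)"
    and bounds: "\<And>x. x \<in> {0<..<1} \<Longrightarrow> \<bar>f' x\<bar> \<in> {m..M}"
    and lip: "\<And>x y. x \<in> {0<..<1} \<Longrightarrow> y \<in> {0<..<1} \<Longrightarrow> \<bar>f' x - f' y\<bar> \<le> K * \<bar>x - y\<bar>"
    and L: "L \<ge> 0"
      "\<And>x y. x \<in> {m..M} \<Longrightarrow> y \<in> {m..M} \<Longrightarrow> \<bar>x powr p - y powr p\<bar> \<le> L * \<bar>x - y\<bar>"
    and K: "K \<ge> 0" and y: "y \<in> {0<..<1}" and x: "x \<in> {0..1}"
  shows "\<bar>\<bar>f x - f y\<bar> powr p - \<bar>f' y\<bar> powr p * \<bar>x - y\<bar> powr p\<bar> \<le> L * K * \<bar>x - y\<bar> powr (p + 1)"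
proof (cases "x = y")
  case False
  obtain z where z: "z \<in> {0<..<1}" "\<bar>z - y\<bar> \<le> \<bar>x - y\<bar>" "f x - f y = f' z * (x - y)"
    using mvt_unit_interval[OF cont der False x] y by auto
  have "\<bar>\<bar>f' z\<bar> powr p - \<bar>f' y\<bar> powr p\<bar> \<le> L * \<bar>\<bar>f' z\<bar> - \<bar>f' y\<bar>\<bar>"
    using L(2) bounds y z by blast
  also have "\<dots> \<le> L * (K * \<bar>x - y\<bar>)"
  proof (intro mult_left_mono L)
    have "\<bar>\<bar>f' z\<bar> - \<bar>f' y\<bar>\<bar> \<le> \<bar>f' z - f' y\<bar>" by (rule abs_triangle_ineq3)
    also have "\<dots> \<le> K * \<bar>z - y\<bar>" by (rule lip[OF z(1) y])
    also have "\<dots> \<le> K * \<bar>x - y\<bar>" by (rule mult_left_mono[OF z(2) K])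
    finally show "\<bar>\<bar>f' z\<bar> - \<bar>f' y\<bar>\<bar> \<le> K * \<bar>x - y\<bar>" .
  qed
  finally have *: "\<bar>\<bar>f' z\<bar> powr p - \<bar>f' y\<bar> powr p\<bar> \<le> L * K * \<bar>x - y\<bar>" by simp
  have "\<bar>\<bar>f x - f y\<bar> powr p - \<bar>f' y\<bar> powr p * \<bar>x - y\<bar> powr p\<bar>
      = \<bar>\<bar>f' z\<bar> powr p - \<bar>f' y\<bar> powr p\<bar> * \<bar>x - y\<bar> powr p"
    unfolding z(3) abs_mult powr_mult left_diff_distrib[symmetric] by simp
  also have "\<dots> \<le> L * K * \<bar>x - y\<bar> * \<bar>x - y\<bar> powr p"
    using * by (intro mult_right_mono) auto
  also have "\<dots> = L * K * \<bar>x - y\<bar> powr (p + 1)"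
    using False by (simp add: powr_add)
  finally show ?thesis .
qed simp

text \<open>The linearization integrated over one horizontal section, with \<open>y = g a\<close> and \<open>u = U a\<close>. The
  factor \<open>p + 1\<close> cancels against the integral of \<open>\<bar>x - y\<bar> powr p\<close>, which is why the main term
  appears with coefficient \<open>1\<close>.\<close>

lemma level_slice_estimate:
  fixes f f' :: "real \<Rightarrow> real" and p :: real
  assumes p: "p \<ge> 0"
    and int: "(\<lambda>x. (p + 1) * \<bar>f x - f y\<bar> powr p) integrable_on {min y u<..<max y u}"
    and lin: "\<And>x. x \<in> {min y u<..<max y u} \<Longrightarrow>
      \<bar>\<bar>f x - f y\<bar> powr p - \<bar>f' y\<bar> powr p * \<bar>x - y\<bar> powr p\<bar> \<le> B * \<bar>x - y\<bar> powr (p + 1)"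
  shows "\<bar>integral {min y u<..<max y u} (\<lambda>x. (p + 1) * \<bar>f x - f y\<bar> powr p)
          - \<bar>f' y\<bar> powr p * \<bar>u - y\<bar> powr (p + 1)\<bar>
         \<le> (p + 1) / (p + 2) * B * \<bar>u - y\<bar> powr (p + 2)"
proof -
  let ?I = "{min y u<..<max y u}"
  let ?\<phi> = "\<lambda>x. (p + 1) * \<bar>f x - f y\<bar> powr p"
  let ?\<psi> = "\<lambda>x. (p + 1) * \<bar>f' y\<bar> powr p * \<bar>x - y\<bar> powr p"
  have \<psi>: "(?\<psi> has_integral \<bar>f' y\<bar> powr p * \<bar>u - y\<bar> powr (p + 1)) ?I"
    using has_integral_mult_right[OF has_integral_dist_powr[of p y u], of "(p + 1) * \<bar>f' y\<bar> powr p"] p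
    by simp
  have E: "((\<lambda>x. (p + 1) * B * \<bar>x - y\<bar> powr (p + 1)) has_integral
      (p + 1) / (p + 2) * B * \<bar>u - y\<bar> powr (p + 2)) ?I"
    using has_integral_mult_right[OF has_integral_dist_powr[of "p + 1" y u], of "(p + 1) * B"] p
    by (simp add: add.assoc)
  have "\<bar>integral ?I ?\<phi> - \<bar>f' y\<bar> powr p * \<bar>u - y\<bar> powr (p + 1)\<bar> = norm (integral ?I (\<lambda>x. ?\<phi> x - ?\<psi> x))"
    unfolding integral_diff[OF int has_integral_integrable[OF \<psi>]] integral_unique[OF \<psi>] by simp
  also have "\<dots> \<le> integral ?I (\<lambda>x. (p + 1) * B * \<bar>x - y\<bar> powr (p + 1))"
  proof (rule integral_norm_bound_integral)
    show "(\<lambda>x. ?\<phi> x - ?\<psi> x) integrable_on ?I"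
      using int \<psi> by (intro integrable_diff) auto
    show "(\<lambda>x. (p + 1) * B * \<bar>x - y\<bar> powr (p + 1)) integrable_on ?I" using E by blast
    fix x assume x: "x \<in> ?I"
    have "norm (?\<phi> x - ?\<psi> x) =
        (p + 1) * \<bar>\<bar>f x - f y\<bar> powr p - \<bar>f' y\<bar> powr p * \<bar>x - y\<bar> powr p\<bar>"
      unfolding mult.assoc right_diff_distrib[symmetric] using p by (simp add: abs_mult)
    also have "\<dots> \<le> (p + 1) * (B * \<bar>x - y\<bar> powr (p + 1))"
      using lin[OF x] p by (intro mult_left_mono) auto
    finally show "norm (?\<phi> x - ?\<psi> x) \<le> (p + 1) * B * \<bar>x - y\<bar> powr (p + 1)" by simp
  qed
  also have "\<dots> = (p + 1) / (p + 2) * B * \<bar>u - y\<bar> powr (p + 2)"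
    using E by (rule integral_unique)
  finally show ?thesis .
qed

section \<open>Regular densities and their inverses\<close>

lemma regular_density_C1:
  assumes "regular_density f"
  defines "f' \<equiv> deriv_within {0..1} f"
  shows "continuous_on {0..1} f" and "continuous_on {0..1} f'"
    and "x \<in> {0<..<1} \<Longrightarrow> (f has_real_derivative f' x) (at x)"
proof -
  have diff: "f differentiable_on {0..1}" "f' differentiable_on {0..1}"
    using assms by (auto simp: regular_density_def twice_cont_diff_on_def)
  then show "continuous_on {0..1} f" "continuous_on {0..1} f'"
    by (auto intro: differentiable_imp_continuous_on)
  show "(f has_real_derivative f' x) (at x)" if "x \<in> {0<..<1}"
  proof -
    have "(f has_vector_derivative f' x) (at x within {0..1})"
      using diff(1) that vector_derivative_works[of f "at x within {0..1}"]
      by (auto simp: differentiable_on_def f'_def deriv_within_def)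
    then show ?thesis
      using that by (simp add: at_within_Icc_at has_real_derivative_iff_has_vector_derivative)
  qed
qed

text \<open>The constants of the linearization: \<open>m\<close> is the infimum of the slopes, while \<open>M\<close> and \<open>K\<close> bound
  the continuous functions \<open>f'\<close> and \<open>f''\<close> on the compact unit interval. Only interior points are
  covered, since the infimum is taken over the open interval and the inverse maps interior levels
  to interior points.\<close>

lemma regular_density_slope_bounds:
  assumes "regular_density f"
  defines "f' \<equiv> deriv_within {0..1} f"
  obtains m M K where "0 < m" "m \<le> M" "0 \<le> K"
    and "\<forall>x\<in>{0<..<1}. \<bar>f' x\<bar> \<in> {m..M}"
    and "\<forall>x\<in>{0<..<1}. \<forall>y\<in>{0<..<1}. \<bar>f' x - f' y\<bar> \<le> K * \<bar>x - y\<bar>"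
proof -
  let ?f'' = "deriv_within {0..1} f'"
  have diff': "f' differentiable_on {0..1}"
    and cont'': "continuous_on {0..1} ?f''"
    and pos: "(INF x\<in>{0<..<1}. \<bar>f' x\<bar>) > 0"
    using assms by (auto simp: regular_density_def twice_cont_diff_on_def)
  have der': "(f' has_real_derivative ?f'' x) (at x within {0..1})" if "x \<in> {0..1}" for x
    using diff' that vector_derivative_works[of f' "at x within {0..1}"]
    by (auto simp: differentiable_on_def deriv_within_def has_real_derivative_iff_has_vector_derivative)
  have bdd: "\<exists>B. \<forall>x\<in>{0..1}. \<bar>\<phi> x\<bar> \<le> B" if "continuous_on {0..1} \<phi>" for \<phi> :: "real \<Rightarrow> real"
  proof -
    have "bounded (\<phi> ` {0..1})"
      using that by (intro compact_imp_bounded compact_continuous_image) auto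
    then show ?thesis unfolding bounded_iff by auto
  qed
  obtain M where M: "\<forall>x\<in>{0..1}. \<bar>f' x\<bar> \<le> M"
    using bdd differentiable_imp_continuous_on[OF diff'] by blast
  obtain K where K: "\<forall>x\<in>{0..1}. \<bar>?f'' x\<bar> \<le> K"
    using bdd[OF cont''] by blast
  define m where "m = (INF x\<in>{0<..<1}. \<bar>f' x\<bar>)"
  have m: "m \<le> \<bar>f' x\<bar>" if "x \<in> {0<..<1}" for x
    unfolding m_def using that by (intro cINF_lower bdd_belowI2[of _ 0]) auto
  show thesis
  proof
    show "0 < m" using pos by (simp add: m_def)
    have "\<bar>f' (1/2)\<bar> \<le> M" using M by auto
    with m[of "1/2"] show "m \<le> M" by simp
    have "\<bar>?f'' 0\<bar> \<le> K" using K by auto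
    then show "0 \<le> K" by linarith
    show "\<forall>x\<in>{0<..<1}. \<bar>f' x\<bar> \<in> {m..M}" using m M by auto
    show "\<forall>x\<in>{0<..<1}. \<forall>y\<in>{0<..<1}. \<bar>f' x - f' y\<bar> \<le> K * \<bar>x - y\<bar>"
      using field_differentiable_bound[of "{0..1}" f' ?f'' K, OF _ der'] K by auto
  qed
qed

lemma regular_density_slope_nonzero:
  assumes "regular_density f" "x \<in> {0<..<1}"
  shows "deriv_within {0..1} f x \<noteq> 0"
proof -
  obtain m M where "0 < m" "\<forall>x\<in>{0<..<1}. \<bar>deriv_within {0..1} f x\<bar> \<in> {m..M}"
    using regular_density_slope_bounds[OF assms(1)] by metis
  then show ?thesis using assms(2) by force
qed

lemma regular_density_strict_decreasing:
  assumes f: "regular_density f" and xy: "0 \<le> x" "x < y" "y \<le> 1"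
  shows "f y < f x"
proof -
  obtain z where "z \<in> {0<..<1}" "f x - f y = deriv_within {0..1} f z * (x - y)"
    using mvt_unit_interval[OF regular_density_C1(1,3)[OF f], of x y] xy by auto
  then have "f x \<noteq> f y"
    using xy regular_density_slope_nonzero[OF f] by auto
  moreover have "f y \<le> f x"
    using f xy unfolding regular_density_def by auto
  ultimately show ?thesis by simp
qed

lemma inv_density_inverse:
  assumes f: "regular_density f"
  defines "g \<equiv> inv_density f"
  shows "a \<in> {f 1..f 0} \<Longrightarrow> g a \<in> {0..1}"
    and "a \<in> {f 1..f 0} \<Longrightarrow> f (g a) = a"
    and "x \<in> {0..1} \<Longrightarrow> a \<in> {f 1..f 0} \<Longrightarrow> f x < a \<longleftrightarrow> g a < x"
    and "x \<in> {0..1} \<Longrightarrow> a \<in> {f 1..f 0} \<Longrightarrow> a < f x \<longleftrightarrow> x < g a"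
    and "continuous_on {f 1..f 0} g"
proof -
  note dec = regular_density_strict_decreasing[OF f]
  have cont: "continuous_on {0..1} f"
    by (rule regular_density_C1[OF f])
  have inj: "inj_on f {0..1}"
    by (rule linorder_inj_onI) (use dec in force)+
  have "\<exists>x\<in>{0..1}. f x = a" if "a \<in> {f 1..f 0}" for a
    using IVT2'[of f 1 a 0] that cont by auto
  moreover have "f x \<in> {f 1..f 0}" if "x \<in> {0..1}" for x
    using that f unfolding regular_density_def by auto
  ultimately have img: "f ` {0..1} = {f 1..f 0}" by blast
  show g: "g a \<in> {0..1}" "f (g a) = a" if "a \<in> {f 1..f 0}" for a
    using that the_inv_into_into[OF inj, of a "{0..1}"] f_the_inv_into_f[OF inj, of a]
    unfolding g_def inv_density_def img by auto
  have mono: "f y \<le> f x" if "0 \<le> x" "x \<le> y" "y \<le> 1" for x y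
    using dec[of x y] that by (cases "x = y") auto
  show "f x < a \<longleftrightarrow> g a < x" if "x \<in> {0..1}" "a \<in> {f 1..f 0}" for x a
    using dec[of "g a" x] mono[of x "g a"] g[OF that(2)] that by force
  show "a < f x \<longleftrightarrow> x < g a" if "x \<in> {0..1}" "a \<in> {f 1..f 0}" for x a
    using dec[of x "g a"] mono[of "g a" x] g[OF that(2)] that by force
  have "continuous_on (f ` {0..1}) g"
    using cont by (rule continuous_on_inv)
      (auto simp: g_def inv_density_def the_inv_into_f_f[OF inj])
  then show "continuous_on {f 1..f 0} g" by (simp add: img)
qed

lemma inv_density_deriv_eq:
  assumes f: "regular_density f" and a: "a \<in> {f 1<..<f 0}"
  shows "inv_density f a \<in> {0<..<1}"
    and "inv_density_deriv f a = inverse (deriv_within {0..1} f (inv_density f a))"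
proof -
  let ?g = "inv_density f"
  note g = inv_density_inverse[OF f]
  show ga: "?g a \<in> {0<..<1}"
    using g(3)[of 1 a] g(4)[of 0 a] a by auto
  have "DERIV ?g a :> inverse (deriv_within {0..1} f (?g a))"
  proof (rule DERIV_inverse_function[where a = "f 1" and b = "f 0"])
    show "DERIV f (?g a) :> deriv_within {0..1} f (?g a)" by (rule regular_density_C1(3)[OF f ga])
    show "deriv_within {0..1} f (?g a) \<noteq> 0" by (rule regular_density_slope_nonzero[OF f ga])
    show "isCont ?g a"
      using g(5) a by (simp add: continuous_on_interior)
  qed (use a g(2) in auto)
  then have "(?g has_vector_derivative inverse (deriv_within {0..1} f (?g a))) (at a within {f 1..f 0})"
    by (simp add: has_vector_derivative_at_within has_real_derivative_iff_has_vector_derivative)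
  then show "inv_density_deriv f a = inverse (deriv_within {0..1} f (?g a))"
    using a unfolding inv_density_deriv_def deriv_within_def
    by (intro vector_derivative_within_closed_interval) auto
qed

section \<open>The inverse of the step function\<close>

text \<open>A nonincreasing function passes the level \<open>a\<close> at \<open>step_inverse h a\<close>. The set in its
  definition contains \<open>s\<close>, hence is nonempty, and nothing to the right of \<open>t\<close> belongs to it.\<close>

lemma step_inverse_crossing:
  fixes h :: "real \<Rightarrow> real"
  assumes dec: "antimono_on {0..1} h"
    and s: "s \<in> {0..1}" "a \<le> h s"
    and t: "\<And>x. x \<in> {t<..1} \<Longrightarrow> h x < a"
  shows "step_inverse h a \<in> {s..t}"
    and "x \<in> {0..1} \<Longrightarrow> x < step_inverse h a \<Longrightarrow> a \<le> h x"
    and "x \<in> {0..1} \<Longrightarrow> step_inverse h a < x \<Longrightarrow> h x < a"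
proof -
  let ?A = "{x\<in>{0..1}. h x \<ge> a}"
  have bdd: "bdd_above ?A" by (rule bdd_aboveI[of _ 1]) auto
  have sA: "s \<in> ?A" using s by simp
  have "step_inverse h a \<le> t"
    unfolding step_inverse_def
  proof (rule cSup_least)
    show "x \<le> t" if "x \<in> ?A" for x using t[of x] that by force
  qed (use sA in blast)
  then show "step_inverse h a \<in> {s..t}"
    using cSup_upper[OF sA bdd] by (simp add: step_inverse_def)
  show "a \<le> h x" if x: "x \<in> {0..1}" "x < step_inverse h a" for x
  proof -
    obtain y where "y \<in> ?A" "x < y"
      using x less_cSup_iff[OF _ bdd, of x] sA unfolding step_inverse_def by blast
    then show ?thesis using monotone_onD[OF dec, of x y] x by auto
  qed
  show "h x < a" if "x \<in> {0..1}" "step_inverse h a < x" for x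
    using cSup_upper[OF _ bdd, of x] that unfolding step_inverse_def by force
qed

text \<open>A monotone function has one-sided limits, so \<open>right_lim h t\<close> is a genuine limit for \<open>t < 1\<close>; for
  \<open>t = 1\<close> there is no \<open>x\<close> to the right.\<close>

lemma le_right_lim:
  fixes h :: "real \<Rightarrow> real"
  assumes dec: "antimono_on {0..1} h" and t: "0 \<le> t" and x: "x \<in> {t<..1}"
  shows "h x \<le> right_lim h t"
proof -
  have "t < 1" using x by auto
  have "((\<lambda>y. - h y) \<longlongrightarrow> Inf ((\<lambda>y. - h y) ` ({t<..} \<inter> {..<1})))
      (at t within ({t<..} \<inter> {..<1}))"
    by (rule Lim_right_bound[where K = "- h t"])
      (use monotone_onD[OF dec] t in auto)
  moreover have "at t within ({t<..} \<inter> {..<1}) = at_right t"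
    by (rule at_within_nhd[of _ "{..<1}"]) (use \<open>t < 1\<close> in auto)
  ultimately obtain l where "((\<lambda>y. - h y) \<longlongrightarrow> l) (at_right t)" by auto
  then have lim: "(h \<longlongrightarrow> - l) (at_right t)"
    using tendsto_minus_cancel_left by fastforce
  have "eventually (\<lambda>y. y \<in> {t<..<x}) (at_right t)"
    using x by (intro eventually_at_right_real) auto
  then have "eventually (\<lambda>y. h x \<le> h y) (at_right t)"
    by eventually_elim (use monotone_onD[OF dec] x t in auto)
  then have "h x \<le> - l"
    by (intro tendsto_lowerbound[OF lim]) auto
  also have "- l = right_lim h t"
    using \<open>t < 1\<close> lim by (auto simp: right_lim_def intro: tendsto_Lim[symmetric])
  finally show ?thesis .
qed

text \<open>What the two situations have in common, and what confines the region between the graphs to the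
  rectangle \<open>{s..t} \<times> {f t..f s}\<close>: the first two facts place \<open>step_inverse h a\<close> in \<open>{s..t}\<close> for
  the levels between \<open>f t\<close> and \<open>f s\<close>, and the third one keeps the graph of \<open>h\<close> in that range of
  levels.\<close>

lemma situation_levels:
  assumes f: "regular_density f"
    and dec: "antimono_on {0..1} h"
    and st: "0 \<le> s" "s < t" "t \<le> 1"
    and sit: "situation_above f h s t \<or> situation_below f h s t"
  shows "f s \<le> h s"
    and "x \<in> {t<..1} \<Longrightarrow> h x \<le> f t"
    and "x \<in> {s<..<t} \<Longrightarrow> h x \<in> {f t..f s}"
proof -
  have h: "h y \<le> h x" if "0 \<le> x" "x \<le> y" "y \<le> 1" for x y
    using monotone_onD[OF dec, of x y] that by auto
  have fm: "f y \<le> f x" if "0 \<le> x" "x \<le> y" "y \<le> 1" for x y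
    using f that unfolding regular_density_def by auto
  show "f s \<le> h s"
    using sit by (auto simp: situation_above_def situation_below_def)
  show "h x \<le> f t" if "x \<in> {t<..1}" for x
    using sit
  proof
    assume "situation_above f h s t"
    then show ?thesis
      using le_right_lim[OF dec _ that] st by (auto simp: situation_above_def)
  next
    assume "situation_below f h s t"
    then show ?thesis
      using h[of t x] that st by (auto simp: situation_below_def)
  qed
  show "h x \<in> {f t..f s}" if "x \<in> {s<..<t}" for x
    using sit
  proof
    assume "situation_above f h s t"
    then show ?thesis
      using h[of s x] fm[of x t] that st by (force simp: situation_above_def)
  next
    assume "situation_below f h s t"
    then show ?thesis
      using h[of x t] fm[of s x] that st by (force simp: situation_below_def)
  qed
qed

section \<open>Comparison of the two integrals\<close>

theorem lemma3p1:
  fixes f :: "real \<Rightarrow> real" and k :: real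
  assumes "regular_density f" and "k \<ge> 1"
  shows "\<exists>C>0. \<forall>(h :: real \<Rightarrow> real) (s :: real) (t :: real).
    dec_step_fun h \<and> (\<forall>x\<in>{0..1}. f 1 \<le> h x \<and> h x \<le> f 0) \<and>
    0 \<le> s \<and> s \<le> t \<and> t \<le> 1 \<and>
    (situation_above f h s t \<or> situation_below f h s t) \<and>
    sup_dist_small f h s t \<longrightarrow>
    \<bar>integral {s..t} (\<lambda>x. \<bar>h x - f x\<bar> powr k)
      - integral {f t..f s} (\<lambda>a. \<bar>step_inverse h a - inv_density f a\<bar> powr k
                                 / \<bar>inv_density_deriv f a\<bar> powr (k - 1))\<bar>
    \<le> C * integral {f t..f s} (\<lambda>a. \<bar>step_inverse h a - inv_density f a\<bar> powr (k + 1)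
                                   / \<bar>inv_density_deriv f a\<bar> powr k)"
proof -
  note f = \<open>regular_density f\<close>
  define f' where "f' = deriv_within {0..1} f"
  define g where "g = inv_density f"
  note cont = regular_density_C1(1)[OF f, folded f'_def]
    and cont' = regular_density_C1(2)[OF f, folded f'_def]
    and der = regular_density_C1(3)[OF f, folded f'_def]
  obtain m M K where m: "0 < m" and mM: "m \<le> M" and K: "0 \<le> K"
    and bounds: "\<And>x. x \<in> {0<..<1} \<Longrightarrow> \<bar>f' x\<bar> \<in> {m..M}"
    and lip: "\<And>x y. x \<in> {0<..<1} \<Longrightarrow> y \<in> {0<..<1} \<Longrightarrow> \<bar>f' x - f' y\<bar> \<le> K * \<bar>x - y\<bar>"
    using regular_density_slope_bounds[OF f, folded f'_def] by metis
  obtain L where L: "L \<ge> 0"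
    "\<And>x y. x \<in> {m..M} \<Longrightarrow> y \<in> {m..M} \<Longrightarrow> \<bar>x powr (k - 1) - y powr (k - 1)\<bar> \<le> L * \<bar>x - y\<bar>"
    using powr_lipschitz_on_positive_interval[OF m mM] by metis
  note g = inv_density_inverse[OF f, folded g_def]
  \<comment> \<open>The constant of the estimate on one horizontal section, for \<open>p = k - 1\<close>.\<close>
  define D where "D = k / (k + 1) * (L * K)"
  have D: "0 \<le> D" using L(1) K \<open>k \<ge> 1\<close> by (simp add: D_def)
  \<comment> \<open>Dividing by \<open>m powr k\<close> absorbs the missing weight \<open>\<bar>f'\<bar> powr k\<close> of the error term; adding \<open>1\<close>
    keeps the constant positive for a linear density, where \<open>D\<close> may vanish.\<close>
  define C where "C = D / m powr k + 1"
  have "C > 0" using D m by (simp add: C_def add_nonneg_pos)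
  moreover have
    "\<bar>integral {s..t} (\<lambda>x. \<bar>h x - f x\<bar> powr k)
      - integral {f t..f s} (\<lambda>a. \<bar>step_inverse h a - inv_density f a\<bar> powr k
                                 / \<bar>inv_density_deriv f a\<bar> powr (k - 1))\<bar>
    \<le> C * integral {f t..f s} (\<lambda>a. \<bar>step_inverse h a - inv_density f a\<bar> powr (k + 1)
                                   / \<bar>inv_density_deriv f a\<bar> powr k)"
    if h: "dec_step_fun h" and st: "0 \<le> s" "s \<le> t" "t \<le> 1"
      and sit: "situation_above f h s t \<or> situation_below f h s t" for h s t
  proof (cases "s = t")
    case False
    with st have "s < t" by simp
    have dec: "antimono_on {0..1} h"
      using h by (auto simp: dec_step_fun_def monotone_on_def)
    note lev = situation_levels[OF f dec st(1) \<open>s < t\<close> st(3) sit]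
    define A where "A = {f t<..<f s}"
    have fdec: "f y \<le> f x" if "0 \<le> x" "x \<le> y" "y \<le> 1" for x y
      using f that unfolding regular_density_def by auto
    have A01: "A \<subseteq> {f 1<..<f 0}"
      using fdec[of 0 s] fdec[of t 1] st by (auto simp: A_def)
    then have A01': "a \<in> {f 1..f 0}" if "a \<in> A" for a using that by fastforce
    define U where "U = step_inverse h"
    have U: "U a \<in> {s..t}" "x \<in> {0..1} \<Longrightarrow> x < U a \<Longrightarrow> a \<le> h x"
      "x \<in> {0..1} \<Longrightarrow> U a < x \<Longrightarrow> h x < a" if "a \<in> A" for a x
    proof -
      have *: "s \<in> {0..1}" "a \<le> h s" "\<And>x. x \<in> {t<..1} \<Longrightarrow> h x < a"
        using st lev(1,2) that by (force simp: A_def)+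
      show "U a \<in> {s..t}" "x \<in> {0..1} \<Longrightarrow> x < U a \<Longrightarrow> a \<le> h x"
        "x \<in> {0..1} \<Longrightarrow> U a < x \<Longrightarrow> h x < a"
        unfolding U_def using step_inverse_crossing[OF dec *] by blast+
    qed
    have g_range: "g a \<in> {s..t}" if "a \<in> A" for a
      using g(3)[of t a] g(4)[of s a] A01'[OF that] that st by (auto simp: A_def)
    have gA: "g a \<in> {0<..<1}" "inv_density_deriv f a = inverse (f' (g a))" if "a \<in> A" for a
      using inv_density_deriv_eq[OF f] A01 that unfolding g_def f'_def by blast+
    have st01: "{s<..<t} \<subseteq> {0..1}" using st by auto

    have f_meas: "f \<in> borel_measurable (restrict_space borel {s<..<t})"
      by (rule borel_measurable_continuous_on_restrict[OF continuous_on_subset[OF cont st01]])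
    have h_meas: "h \<in> borel_measurable (restrict_space borel {s<..<t})"
      using dec st01 by (intro antimono_on_borel_measurable) (auto intro: monotone_on_subset)
    \<comment> \<open>If \<open>U\<close> increased from \<open>a\<close> to a higher level \<open>b\<close>, then at a position strictly between
      \<open>U a\<close> and \<open>U b\<close> the value of \<open>h\<close> would be below \<open>a\<close> and at least \<open>b\<close>.\<close>
    have U_anti: "antimono_on A U"
    proof (rule monotone_onI)
      fix a b assume ab: "a \<in> A" "b \<in> A" "a \<le> b"
      show "U b \<le> U a"
      proof (rule ccontr)
        assume "\<not> U b \<le> U a"
        then obtain x where x: "U a < x" "x < U b" using dense[of "U a" "U b"] by auto
        moreover have "x \<in> {0..1}" using x U(1)[OF ab(1)] U(1)[OF ab(2)] st by auto
        ultimately show False using U(3)[OF ab(1)] U(2)[OF ab(2)] ab(3) by force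
      qed
    qed
    have U_meas [measurable]: "U \<in> borel_measurable (restrict_space borel A)"
      by (rule antimono_on_borel_measurable[OF U_anti])
    have g_cont: "continuous_on A g"
      by (rule continuous_on_subset[OF g(5)]) (use A01' in blast)
    have g_meas [measurable]: "g \<in> borel_measurable (restrict_space borel A)"
      by (rule borel_measurable_continuous_on_restrict[OF g_cont])
    have [measurable]: "(\<lambda>a. f' (g a)) \<in> borel_measurable (restrict_space borel A)"
      using gA(1)
      by (intro borel_measurable_continuous_on_restrict continuous_on_compose2[OF cont' g_cont]) force

    define G where "G = (\<lambda>a. integral {min (g a) (U a)<..<max (g a) (U a)}
                      (\<lambda>x. k * \<bar>f x - a\<bar> powr (k - 1)))"
    have G_slice: "\<And>a. a \<in> A \<Longrightarrow> (\<lambda>x. k * \<bar>f x - a\<bar> powr (k - 1))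
           integrable_on {min (g a) (U a)<..<max (g a) (U a)}"
      and G_int: "G integrable_on A"
      and G_eq: "integral {s<..<t} (\<lambda>x. \<bar>h x - f x\<bar> powr k) = integral A G"
    proof -
      have f_range: "f x \<in> {f t..f s}" if "x \<in> {s<..<t}" for x
        using fdec[of s x] fdec[of x t] that st by auto
      have g_cross: "(f x < a \<longleftrightarrow> g a < x) \<and> (a < f x \<longleftrightarrow> x < g a)"
        if "x \<in> {s<..<t}" "a \<in> {f t<..<f s}" for x a
        using g(3,4)[of x a] A01'[of a] that st01 unfolding A_def by blast
      have U_cross: "(x < U a \<longrightarrow> a \<le> h x) \<and> (U a < x \<longrightarrow> h x < a)"
        if "x \<in> {s<..<t}" "a \<in> {f t<..<f s}" for x a
        using U(2,3)[of a x] that st01 unfolding A_def by blast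
      note * = integral_deviation_power_by_level[where p = "k - 1" and f = f and h = h and g = g and U = U,
          OF _ f_meas h_meas f_range lev(3) g_range[unfolded A_def] U(1)[unfolded A_def] g_cross U_cross]
      show "(\<lambda>x. k * \<bar>f x - a\<bar> powr (k - 1))
           integrable_on {min (g a) (U a)<..<max (g a) (U a)}" if "a \<in> A" for a
        using *(1)[of a] that \<open>k \<ge> 1\<close> unfolding A_def by simp
      show "G integrable_on A" "integral {s<..<t} (\<lambda>x. \<bar>h x - f x\<bar> powr k) = integral A G"
        using *(2,3) \<open>k \<ge> 1\<close> unfolding A_def G_def by simp_all
    qed

    \<comment> \<open>The integrands of the statement after substituting \<open>1 / f' (g a)\<close> for the derivative of
      the inverse.\<close>
    define P where "P = (\<lambda>a. \<bar>U a - g a\<bar> powr k * \<bar>f' (g a)\<bar> powr (k - 1))"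
    define Q where "Q = (\<lambda>a. \<bar>U a - g a\<bar> powr (k + 1) * \<bar>f' (g a)\<bar> powr k)"
    have dist1: "\<bar>U a - g a\<bar> \<le> 1" if "a \<in> A" for a
      using U(1)[OF that] g_range[OF that] st by auto
    have bdd: "\<bar>\<bar>U a - g a\<bar> powr q * \<bar>f' (g a)\<bar> powr r\<bar> \<le> M powr r"
      if "a \<in> A" "q \<ge> 0" "r \<ge> 0" for a q r
    proof -
      have "\<bar>U a - g a\<bar> powr q \<le> 1"
        using powr_mono2[of q "\<bar>U a - g a\<bar>" 1] dist1 that by simp
      moreover have "\<bar>f' (g a)\<bar> powr r \<le> M powr r"
        using bounds[OF gA(1)[OF that(1)]] that by (intro powr_mono2) auto
      ultimately have "\<bar>U a - g a\<bar> powr q * \<bar>f' (g a)\<bar> powr r \<le> 1 * M powr r"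
        by (intro mult_mono) auto
      then show ?thesis by simp
    qed
    have "(\<lambda>a. \<bar>U a - g a\<bar> powr q * \<bar>f' (g a)\<bar> powr r) integrable_on A"
      if "q \<ge> 0" "r \<ge> 0" for q r
    proof -
      have "set_integrable lborel A (\<lambda>a. \<bar>U a - g a\<bar> powr q * \<bar>f' (g a)\<bar> powr r)"
        unfolding A_def
      proof (rule set_integrable_bounded_interval)
        show "(\<lambda>a. \<bar>U a - g a\<bar> powr q * \<bar>f' (g a)\<bar> powr r)
            \<in> borel_measurable (restrict_space borel {f t<..<f s})"
          unfolding A_def[symmetric] by measurable
        show "\<bar>\<bar>U a - g a\<bar> powr q * \<bar>f' (g a)\<bar> powr r\<bar> \<le> M powr r"
          if "a \<in> {f t<..<f s}" for a
          using bdd \<open>q \<ge> 0\<close> \<open>r \<ge> 0\<close> that unfolding A_def by blast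
      qed
      then show ?thesis by (rule set_borel_integral_eq_integral(1))
    qed
    then have P_int: "P integrable_on A" and Q_int: "Q integrable_on A"
      using \<open>k \<ge> 1\<close> by (simp_all add: P_def Q_def)
    have slice: "\<bar>G a - P a\<bar> \<le> C * Q a" if "a \<in> A" for a
    proof -
      have fga: "f (g a) = a" using g(2) A01' that by blast
      have lin: "\<bar>\<bar>f x - f (g a)\<bar> powr (k - 1) - \<bar>f' (g a)\<bar> powr (k - 1) * \<bar>x - g a\<bar> powr (k - 1)\<bar>
          \<le> (L * K) * \<bar>x - g a\<bar> powr (k - 1 + 1)"
        if x: "x \<in> {min (g a) (U a)<..<max (g a) (U a)}" for x
      proof -
        have "x \<in> {0..1}"
          using x U(1)[OF \<open>a \<in> A\<close>] g_range[OF \<open>a \<in> A\<close>] st by auto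
        then show ?thesis
          by (intro deviation_power_linearization[OF cont der bounds lip L K gA(1)]) (use that \<open>a \<in> A\<close> in auto)
      qed
      have "\<bar>G a - P a\<bar> \<le> D * \<bar>U a - g a\<bar> powr (k + 1)"
        using level_slice_estimate[of "k - 1" f "g a" "U a" f' "L * K", OF _ _ lin]
          G_slice[OF that] \<open>k \<ge> 1\<close>
        by (simp add: fga G_def P_def D_def mult.commute add.commute)
      also have "\<dots> = D / m powr k * (\<bar>U a - g a\<bar> powr (k + 1) * m powr k)"
        using m by simp
      also have "\<dots> \<le> C * Q a"
        unfolding C_def Q_def using D m bounds[OF gA(1)[OF that]] \<open>k \<ge> 1\<close>
        by (intro mult_mono powr_mono2) auto
      finally show ?thesis .
    qed
    have "\<bar>integral A G - integral A P\<bar> = norm (integral A (\<lambda>a. G a - P a))"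
      using G_int P_int by (simp add: integral_diff)
    also have "\<dots> \<le> integral A (\<lambda>a. C * Q a)"
      using slice by (intro integral_norm_bound_integral integrable_diff G_int P_int
          integrable_on_mult_right Q_int) auto
    finally have "\<bar>integral A G - integral A P\<bar> \<le> C * integral A Q" by simp
    moreover have "integral {f t..f s} (\<lambda>a. \<bar>step_inverse h a - inv_density f a\<bar> powr q
        / \<bar>inv_density_deriv f a\<bar> powr r) = integral A (\<lambda>a. \<bar>U a - g a\<bar> powr q * \<bar>f' (g a)\<bar> powr r)"
      for q r
      unfolding integral_open_interval_real A_def[symmetric]
    proof (rule integral_cong)
      show "\<bar>step_inverse h a - inv_density f a\<bar> powr q / \<bar>inv_density_deriv f a\<bar> powr r
          = \<bar>U a - g a\<bar> powr q * \<bar>f' (g a)\<bar> powr r" if "a \<in> A" for a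
        unfolding gA(2)[OF that] U_def[symmetric] g_def[symmetric]
        by (simp add: inverse_powr divide_inverse)
    qed
    ultimately show ?thesis
      by (simp add: P_def Q_def G_eq integral_open_interval_real[of s t])
  qed simp
  ultimately show ?thesis by blast
qed

end
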